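(* For each $n\in\mathbb N$ and all compact networks $X,Y$, $d_n(\mathcal M_n(X),\mathcal M_n(Y))\le 2\,d_{\mathcal N}(X,Y)$, and $2$ is the least constant for which this inequality holds for all compact networks $X,Y$.
   Context: A network is a pair $(X,\omega_X)$ with $X$ a first countable topological space and $\omega_X:X\times X\to\mathbb R$ continuous; it is compact if $X$ is compact. For $n\in\mathbb N$, the $n$-motif set is $\mathcal M_n(X)=\{(\omega_X(x_i,x_j))_{i,j=1}^n: x_1,\dots,x_n\in X\}\subseteq\mathbb R^{n\times n}$ (a closed set), and $d_n$ is the Hausdorff distance between closed subsets of $\mathbb R^{n\times n}$ with respect to the $\ell^\infty$ metric on $\mathbb R^{n\times n}$. A correspondence is a relation $R\subseteq X\times Y$ with surjective projections; $\mathrm{dis}(R)=\sup_{(x,y),(x',y')\in R}|\omega_X(x,x')-\omega_Y(y,y')|$; $d_{\mathcal N}(X,Y)=\tfrac12\inf_R\mathrm{dis}(R)$. *)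

theory Defs
  imports "HOL-Analysis.Analysis" "Jordan_Normal_Form.Matrix"
begin

text \<open>
  A network is a pair of a topological space \<open>X\<close> (with carrier \<open>topspace X\<close>) and a weight function
  \<open>w\<close>, whose values outside \<open>topspace X \<times> topspace X\<close> never matter.  The carrier may be empty.
\<close>

definition network :: "'a topology \<Rightarrow> ('a \<times> 'a \<Rightarrow> real) \<Rightarrow> bool" where
  "network X w \<longleftrightarrow> first_countable X \<and> continuous_map (prod_topology X X) euclideanreal w"

definition compact_network :: "'a topology \<Rightarrow> ('a \<times> 'a \<Rightarrow> real) \<Rightarrow> bool" where
  "compact_network X w \<longleftrightarrow> network X w \<and> compact_space X"

definition motif_set :: "nat \<Rightarrow> 'a topology \<Rightarrow> ('a \<times> 'a \<Rightarrow> real) \<Rightarrow> real mat set" where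
  "motif_set n X w =
     {mat n n (\<lambda>(i, j). w (x i, x j)) | x :: nat \<Rightarrow> 'a. \<forall>i<n. x i \<in> topspace X}"

text \<open>The \<open>\<ell>\<^sup>\<infinity>\<close> metric on \<open>n \<times> n\<close> matrices; only meaningful for \<open>n \<ge> 1\<close>.\<close>

definition linf_dist :: "nat \<Rightarrow> real mat \<Rightarrow> real mat \<Rightarrow> real" where
  "linf_dist n A B = Max {\<bar>A $$ (i, j) - B $$ (i, j)\<bar> | i j. i < n \<and> j < n}"

text \<open>
  The distances below are valued in \<open>[0, \<infinity>]\<close>, where suprema and infima always exist, with
  \<open>Sup {} = 0\<close> and \<open>Inf {} = \<infinity>\<close>.  Thus the Hausdorff distance of the empty set to a nonempty set is
  \<open>\<infinity>\<close>, as is the network distance between an empty and a nonempty network (there is no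
  correspondence), while two empty sets or networks have distance \<open>0\<close>.  For nonempty compact networks
  all values are finite.
\<close>

definition hausdorff_dist :: "('m \<Rightarrow> 'm \<Rightarrow> real) \<Rightarrow> 'm set \<Rightarrow> 'm set \<Rightarrow> ennreal" where
  "hausdorff_dist d A B =
     max (SUP a\<in>A. INF b\<in>B. ennreal (d a b)) (SUP b\<in>B. INF a\<in>A. ennreal (d a b))"

definition motif_dist :: "nat \<Rightarrow> real mat set \<Rightarrow> real mat set \<Rightarrow> ennreal" where
  "motif_dist n = hausdorff_dist (linf_dist n)"

definition correspondence :: "'a set \<Rightarrow> 'b set \<Rightarrow> ('a \<times> 'b) set \<Rightarrow> bool" where
  "correspondence S T R \<longleftrightarrow> R \<subseteq> S \<times> T \<and> fst ` R = S \<and> snd ` R = T"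

definition distortion ::
  "('a \<times> 'a \<Rightarrow> real) \<Rightarrow> ('b \<times> 'b \<Rightarrow> real) \<Rightarrow> ('a \<times> 'b) set \<Rightarrow> ennreal" where
  "distortion wX wY R = (SUP (x, y)\<in>R. SUP (x', y')\<in>R. ennreal \<bar>wX (x, x') - wY (y, y')\<bar>)"

definition network_dist ::
  "'a topology \<Rightarrow> ('a \<times> 'a \<Rightarrow> real) \<Rightarrow> 'b topology \<Rightarrow> ('b \<times> 'b \<Rightarrow> real) \<Rightarrow> ennreal" where
  "network_dist X wX Y wY =
     (INF R\<in>{R. correspondence (topspace X) (topspace Y) R}. distortion wX wY R) / 2"

end

theory Submission
  imports Defs
begin

text \<open>
  A correspondence matches the points defining a motif of one network with points of the other, and
  no entry of the two motifs then differs by more than the distortion.  One-point networks of weights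
  \<open>0\<close> and \<open>1\<close> attain equality.
\<close>

text \<open>For \<open>n \<ge> 1\<close> the set under \<open>Max\<close> is finite and nonempty, so
  the maximum is one of its elements. Later estimates of \<open>linf_dist\<close> thereby reduce to
  a single entry.\<close>

lemma linf_dist_attained:
  assumes "n \<ge> 1"
  obtains i j where "i < n" "j < n" "linf_dist n A B = \<bar>A $$ (i, j) - B $$ (i, j)\<bar>"
proof -
  let ?S = "{\<bar>A $$ (i, j) - B $$ (i, j)\<bar> | i j. i < n \<and> j < n}"
  have "?S = (\<lambda>(i, j). \<bar>A $$ (i, j) - B $$ (i, j)\<bar>) ` ({..<n} \<times> {..<n})"
    by auto
  then have "finite ?S"
    by simp
  moreover have "0 < n"
    using assms by simp
  then have "?S \<noteq> {}"
    by blast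
  ultimately have "linf_dist n A B \<in> ?S"
    unfolding linf_dist_def by (rule Max_in)
  then show ?thesis
    using that by blast
qed

lemma abs_diff_le_distortion:
  assumes "(x, y) \<in> R" "(x', y') \<in> R"
  shows "ennreal \<bar>wX (x, x') - wY (y, y')\<bar> \<le> distortion wX wY R"
  unfolding distortion_def using assms by (auto intro!: SUP_upper2)

text \<open>At a maximal entry \<open>(i, j)\<close>, the pairs \<open>(x i, y i)\<close> and
  \<open>(x j, y j)\<close> both lie in \<open>R\<close>, so the difference there is one of the
  values whose supremum is the distortion.\<close>

lemma linf_dist_le_distortion:
  assumes "n \<ge> 1" and "\<And>i. i < n \<Longrightarrow> (x i, y i) \<in> R"
  shows "ennreal (linf_dist n (mat n n (\<lambda>(i, j). wX (x i, x j))) (mat n n (\<lambda>(i, j). wY (y i, y j))))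
           \<le> distortion wX wY R"
proof -
  let ?A = "mat n n (\<lambda>(i, j). wX (x i, x j))" and ?B = "mat n n (\<lambda>(i, j). wY (y i, y j))"
  obtain i j where "i < n" "j < n" "linf_dist n ?A ?B = \<bar>?A $$ (i, j) - ?B $$ (i, j)\<bar>"
    using linf_dist_attained[OF assms(1)] .
  then show ?thesis
    using abs_diff_le_distortion[OF assms(2) assms(2), of i j] by simp
qed

lemma motif_dist_le_distortion:
  assumes "n \<ge> 1" and R: "correspondence (topspace X) (topspace Y) R"
  shows "motif_dist n (motif_set n X wX) (motif_set n Y wY) \<le> distortion wX wY R"
  unfolding motif_dist_def hausdorff_dist_def
proof (intro max.boundedI SUP_least)
  fix A assume "A \<in> motif_set n X wX"
  then obtain x where A: "A = mat n n (\<lambda>(i, j). wX (x i, x j))" and x: "\<forall>i<n. x i \<in> topspace X"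
    unfolding motif_set_def by blast
  \<comment> \<open>The first projection of \<open>R\<close> is onto, so each point has a partner.
    Choosing one partner per index gives a motif of \<open>Y\<close>, a witness that bounds the
    infimum from above.\<close>
  have "\<forall>i<n. \<exists>y. (x i, y) \<in> R"
    using x R unfolding correspondence_def by force
  then obtain y where y: "\<And>i. i < n \<Longrightarrow> (x i, y i) \<in> R"
    by metis
  then have "mat n n (\<lambda>(i, j). wY (y i, y j)) \<in> motif_set n Y wY"
    using R unfolding motif_set_def correspondence_def by blast
  then show "(INF B\<in>motif_set n Y wY. ennreal (linf_dist n A B)) \<le> distortion wX wY R"
    unfolding A by (rule INF_lower2) (rule linf_dist_le_distortion[where wX = wX and wY = wY, OF assms(1) y])
next
  \<comment> \<open>Now the second projection supplies the partners. In both halves of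
    \<open>hausdorff_dist\<close> the matrix from \<open>X\<close> is the first argument of the
    metric, so the same estimate applies without appeal to symmetry.\<close>
  fix B assume "B \<in> motif_set n Y wY"
  then obtain y where B: "B = mat n n (\<lambda>(i, j). wY (y i, y j))" and y: "\<forall>i<n. y i \<in> topspace Y"
    unfolding motif_set_def by blast
  have "\<forall>i<n. \<exists>x. (x, y i) \<in> R"
    using y R unfolding correspondence_def by force
  then obtain x where x: "\<And>i. i < n \<Longrightarrow> (x i, y i) \<in> R"
    by metis
  then have "mat n n (\<lambda>(i, j). wX (x i, x j)) \<in> motif_set n X wX"
    using R unfolding motif_set_def correspondence_def by blast
  then show "(INF A\<in>motif_set n X wX. ennreal (linf_dist n A B)) \<le> distortion wX wY R"
    unfolding B by (rule INF_lower2) (rule linf_dist_le_distortion[where wX = wX and wY = wY, OF assms(1) x])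
qed

text \<open>The factor 2 undoes the halving in \<open>network_dist\<close>. If there is no
  correspondence, the infimum is \<infinity> and the bound is trivial.\<close>

lemma motif_dist_le_network_dist:
  assumes "n \<ge> 1"
  shows "motif_dist n (motif_set n X wX) (motif_set n Y wY) \<le> 2 * network_dist X wX Y wY"
proof -
  have "motif_dist n (motif_set n X wX) (motif_set n Y wY)
          \<le> (INF R\<in>{R. correspondence (topspace X) (topspace Y) R}. distortion wX wY R)"
    using motif_dist_le_distortion[OF assms] by (auto intro!: INF_greatest)
  also have "\<dots> = 2 * network_dist X wX Y wY"
    \<comment> \<open>Multiplying and then dividing by 2 cancels even at \<infinity>, because 2 is
      neither 0 nor \<infinity>.\<close>
    unfolding network_dist_def ennreal_times_divide mult.commute[of 2]
    by (rule ennreal_mult_divide_eq[symmetric]) simp_all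
  finally show ?thesis .
qed

lemma compact_network_singleton:
  "compact_network (discrete_topology {a}) (\<lambda>_. r)"
  unfolding compact_network_def network_def
  by (simp add: compact_space_discrete_topology first_countable_discrete_topology)

lemma motif_set_singleton:
  "motif_set n (discrete_topology {a}) (\<lambda>_. r) = {mat n n (\<lambda>_. r)}"
  unfolding motif_set_def by (auto simp: case_prod_unfold)

lemma motif_dist_singleton:
  assumes "n \<ge> 1"
  shows "motif_dist n (motif_set n (discrete_topology {a}) (\<lambda>_. r))
           (motif_set n (discrete_topology {b}) (\<lambda>_. s)) = ennreal \<bar>r - s\<bar>"
proof -
  have "linf_dist n (mat n n (\<lambda>_. r)) (mat n n (\<lambda>_. s)) = \<bar>r - s\<bar>"
    by (rule linf_dist_attained[OF assms, of "mat n n (\<lambda>_. r)" "mat n n (\<lambda>_. s)"]) simp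
  then show ?thesis
    unfolding motif_set_singleton motif_dist_def hausdorff_dist_def by simp
qed

text \<open>The pair \<open>(a, b)\<close> alone forms a correspondence of distortion
  \<open>\<bar>r - s\<bar>\<close>. An upper bound suffices: in the optimality argument the network
  distance stands on the larger side.\<close>

lemma network_dist_singleton:
  "network_dist (discrete_topology {a}) (\<lambda>_. r) (discrete_topology {b}) (\<lambda>_. s) \<le> ennreal (\<bar>r - s\<bar> / 2)"
proof -
  have "correspondence {a} {b} {(a, b)}"
    unfolding correspondence_def by simp
  moreover have "distortion (\<lambda>_. r) (\<lambda>_. s) {(a, b)} = ennreal \<bar>r - s\<bar>"
    unfolding distortion_def by simp
  ultimately have "(INF R\<in>{R. correspondence {a} {b} R}. distortion (\<lambda>_. r) (\<lambda>_. s) R) \<le> ennreal \<bar>r - s\<bar>"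
    by (metis INF_lower mem_Collect_eq)
  then have "network_dist (discrete_topology {a}) (\<lambda>_. r) (discrete_topology {b}) (\<lambda>_. s)
      \<le> ennreal \<bar>r - s\<bar> / 2"
    unfolding network_dist_def by (simp add: divide_right_mono_ennreal)
  also have "\<dots> = ennreal (\<bar>r - s\<bar> / 2)"
    by (simp add: divide_ennreal[symmetric])
  finally show ?thesis .
qed

theorem mainTheorem7:
  fixes n :: nat
  assumes "n \<ge> 1"
  shows "(\<forall>(X :: 'a topology) wX (Y :: 'b topology) wY.
             compact_network X wX \<and> compact_network Y wY \<longrightarrow>
             motif_dist n (motif_set n X wX) (motif_set n Y wY) \<le> 2 * network_dist X wX Y wY)
       \<and> (\<forall>c :: real.
             (\<forall>(X :: 'a topology) wX (Y :: 'b topology) wY.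
                compact_network X wX \<and> compact_network Y wY \<longrightarrow>
                motif_dist n (motif_set n X wX) (motif_set n Y wY)
                  \<le> ennreal c * network_dist X wX Y wY)
             \<longrightarrow> 2 \<le> c)"
proof (intro conjI allI impI)
  fix X :: "'a topology" and wX and Y :: "'b topology" and wY
  show "motif_dist n (motif_set n X wX) (motif_set n Y wY) \<le> 2 * network_dist X wX Y wY"
    by (rule motif_dist_le_network_dist[OF assms])
next
  fix c :: real
  assume c: "\<forall>(X :: 'a topology) wX (Y :: 'b topology) wY.
                compact_network X wX \<and> compact_network Y wY \<longrightarrow>
                motif_dist n (motif_set n X wX) (motif_set n Y wY)
                  \<le> ennreal c * network_dist X wX Y wY"
  \<comment> \<open>The carrier types are arbitrary; \<open>undefined\<close> merely names some
    element of each, so the constant is optimal for every pair of types.\<close>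
  let ?X = "discrete_topology {undefined :: 'a}" and ?Y = "discrete_topology {undefined :: 'b}"
  have "ennreal 1 = motif_dist n (motif_set n ?X (\<lambda>_. 0)) (motif_set n ?Y (\<lambda>_. 1))"
    using motif_dist_singleton[OF assms, of "undefined :: 'a" 0 "undefined :: 'b" 1] by simp
  also have "\<dots> \<le> ennreal c * network_dist ?X (\<lambda>_. 0) ?Y (\<lambda>_. 1)"
    by (intro c[rule_format] conjI compact_network_singleton)
  also have "\<dots> \<le> ennreal c * ennreal (1 / 2)"
    using network_dist_singleton[of "undefined :: 'a" 0 "undefined :: 'b" 1]
    by (intro mult_left_mono) auto
  \<comment> \<open>The sign of \<open>c\<close> is not known here. For negative \<open>c\<close>
    both sides are 0, and the final comparison with \<open>ennreal 1\<close> then excludes that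
    case.\<close>
  also have "\<dots> = ennreal (c / 2)"
    by (subst ennreal_mult''[symmetric]) simp_all
  finally show "2 \<le> c"
    by (simp add: ennreal_le_iff2)
qed

end
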